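(* Let $Z(\lambda)=\sum_jx_j(\lambda)$. For every $\lambda\in\mathbb R^m$, $$\min_{t\in\mathbb R}\phi_{\rm se}(\lambda+tq)=\phi_{\rm lse}(\lambda)+\gamma,\qquad t^\star(\lambda)=-\gamma\log Z(\lambda)$$ (where $t^\star(\lambda)$ is the minimizer in $t$), and $x(\lambda+t^\star(\lambda)q)=p(\lambda)$. Writing $F_{\rm se}:=\phi_{\rm se}-\phi_{\rm se}^\star$ and $F_{\rm lse}:=\phi_{\rm lse}-\phi_{\rm lse}^\star$, $$F_{\rm se}(\lambda)=F_{\rm lse}(\lambda)+\gamma\bigl(Z(\lambda)-1-\log Z(\lambda)\bigr),\qquad F_{\rm lse}(\lambda)=\gamma\,\mathrm{KL}(x^\star\|p(\lambda)).$$
   Context: Let $A\in\mathbb R^{m\times n}$ with columns $a_1,\dots,a_n$, $b\in\mathbb R^m$, $c\in\mathbb R^n$, $\gamma>0$. Standing assumption: $q\in\mathbb R^m$ satisfies $A^\top q=\mathbf 1$ and $\langle q,b\rangle=1$, and there is $\bar x>0$ (entrywise) with $A\bar x=b$. The primal problem is $\min_{x\ge0}\{\langle c,x\rangle+\gamma\sum_jx_j(\log x_j-1):Ax=b,\ \mathbf 1^\top x=1\}$, with unique solution $x^\star$. The two duals are $\phi_{\rm lse}(\lambda)=-\langle b,\lambda\rangle+\gamma\log\sum_{j=1}^n\exp((a_j^\top\lambda-c_j)/\gamma)$ and $\phi_{\rm se}(\lambda)=-\langle b,\lambda\rangle+\gamma\sum_{j=1}^n\exp((a_j^\top\lambda-c_j)/\gamma)$,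 with minimal values $\phi_{\rm lse}^\star,\phi_{\rm se}^\star$. The unnormalized response is $x_j(\lambda)=\exp((a_j^\top\lambda-c_j)/\gamma)$ and the normalized response is $p_j(\lambda)=x_j(\lambda)/Z(\lambda)$. $\mathrm{KL}(x\|p)=\sum_jx_j\log(x_j/p_j)$. *)

theory Defs
  imports "HOL-Analysis.Analysis"
begin

(* Vectors are indexed by finite types: 'm for the rows and 'n for the columns of A. *)

definition feasible :: "real^'n^'m \<Rightarrow> real^'m \<Rightarrow> real^'n \<Rightarrow> bool" where
  "feasible A b x \<longleftrightarrow> (\<forall>j. 0 \<le> x $ j) \<and> A *v x = b \<and> 1 \<bullet> x = 1"

(* Since 0 * y = 0, the summand at x $ j = 0 is 0, which is the convention 0 log 0 = 0. *)
definition primal_obj :: "real^'n \<Rightarrow> real \<Rightarrow> real^'n \<Rightarrow> real" where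
  "primal_obj c \<gamma> x = c \<bullet> x + \<gamma> * (\<Sum>j\<in>UNIV. x $ j * (ln (x $ j) - 1))"

definition primal_solution ::
    "real^'n^'m \<Rightarrow> real^'m \<Rightarrow> real^'n \<Rightarrow> real \<Rightarrow> real^'n \<Rightarrow> bool" where
  "primal_solution A b c \<gamma> x \<longleftrightarrow> is_arg_min (primal_obj c \<gamma>) (feasible A b) x"

definition x_star :: "real^'n^'m \<Rightarrow> real^'m \<Rightarrow> real^'n \<Rightarrow> real \<Rightarrow> real^'n" where
  "x_star A b c \<gamma> = (THE x. primal_solution A b c \<gamma> x)"

definition x_resp :: "real^'n^'m \<Rightarrow> real^'n \<Rightarrow> real \<Rightarrow> real^'m \<Rightarrow> real^'n" where
  "x_resp A c \<gamma> l = (\<chi> j. exp ((column j A \<bullet> l - c $ j) / \<gamma>))"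

definition Z :: "real^'n^'m \<Rightarrow> real^'n \<Rightarrow> real \<Rightarrow> real^'m \<Rightarrow> real" where
  "Z A c \<gamma> l = (\<Sum>j\<in>UNIV. x_resp A c \<gamma> l $ j)"

definition p_resp :: "real^'n^'m \<Rightarrow> real^'n \<Rightarrow> real \<Rightarrow> real^'m \<Rightarrow> real^'n" where
  "p_resp A c \<gamma> l = (\<chi> j. x_resp A c \<gamma> l $ j / Z A c \<gamma> l)"

definition phi_lse ::
    "real^'n^'m \<Rightarrow> real^'m \<Rightarrow> real^'n \<Rightarrow> real \<Rightarrow> real^'m \<Rightarrow> real" where
  "phi_lse A b c \<gamma> l =
     - (b \<bullet> l) + \<gamma> * ln (\<Sum>j\<in>UNIV. exp ((column j A \<bullet> l - c $ j) / \<gamma>))"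

definition phi_se ::
    "real^'n^'m \<Rightarrow> real^'m \<Rightarrow> real^'n \<Rightarrow> real \<Rightarrow> real^'m \<Rightarrow> real" where
  "phi_se A b c \<gamma> l =
     - (b \<bullet> l) + \<gamma> * (\<Sum>j\<in>UNIV. exp ((column j A \<bullet> l - c $ j) / \<gamma>))"

(* Inf on the reals is meaningful here only for a set bounded below; where these two
   values are used, it is also stated that the minima are attained. *)
definition phi_lse_star :: "real^'n^'m \<Rightarrow> real^'m \<Rightarrow> real^'n \<Rightarrow> real \<Rightarrow> real" where
  "phi_lse_star A b c \<gamma> = (INF l. phi_lse A b c \<gamma> l)"

definition phi_se_star :: "real^'n^'m \<Rightarrow> real^'m \<Rightarrow> real^'n \<Rightarrow> real \<Rightarrow> real" where
  "phi_se_star A b c \<gamma> = (INF l. phi_se A b c \<gamma> l)"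

definition F_lse ::
    "real^'n^'m \<Rightarrow> real^'m \<Rightarrow> real^'n \<Rightarrow> real \<Rightarrow> real^'m \<Rightarrow> real" where
  "F_lse A b c \<gamma> l = phi_lse A b c \<gamma> l - phi_lse_star A b c \<gamma>"

definition F_se ::
    "real^'n^'m \<Rightarrow> real^'m \<Rightarrow> real^'n \<Rightarrow> real \<Rightarrow> real^'m \<Rightarrow> real" where
  "F_se A b c \<gamma> l = phi_se A b c \<gamma> l - phi_se_star A b c \<gamma>"

definition KL :: "real^'n \<Rightarrow> real^'n \<Rightarrow> real" where
  "KL x p = (\<Sum>j\<in>UNIV. x $ j * ln (x $ j / p $ j))"

end

theory Submission
  imports Defs
begin

text \<open>
  Everything follows from one identity and one existence fact. The identity
  (\<open>gamma_KL_eq_duality_gap\<close>) says that for every feasible \<open>x\<close> and every \<open>\<lambda>\<close> the duality gap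
  between the primal value at \<open>x\<close> and the log-sum-exp dual at \<open>\<lambda>\<close> is exactly \<open>\<gamma> KL(x \<parallel> p(\<lambda>))\<close>, which
  is nonnegative and vanishes only for \<open>x = p(\<lambda>)\<close>. Hence, if some response \<open>x(\<lambda>\<^sub>0)\<close>
  is feasible, so that \<open>Z(\<lambda>\<^sub>0) = 1\<close> and \<open>p(\<lambda>\<^sub>0) = x(\<lambda>\<^sub>0)\<close>, then it is the unique primal solution,
  \<open>\<lambda>\<^sub>0\<close> minimizes the log-sum-exp dual, and the suboptimality of any \<open>\<lambda>\<close> is
  \<open>\<gamma> KL(x\<^sup>\<star> \<parallel> p(\<lambda>))\<close>.

  Such a \<open>\<lambda>\<^sub>0\<close> is any minimizer of the sum-exp dual, because stationarity there reads
  \<open>A x(\<lambda>\<^sub>0) = b\<close>, and pairing with \<open>q\<close> gives unit mass. A minimizer exists because, with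
  \<open>b = A x\<close> for a positive \<open>x\<close>, the sum-exp dual is a function of \<open>u = A\<^sup>T \<lambda>\<close> alone, separable and
  coercive in \<open>u\<close>, and \<open>u\<close> ranges over a closed subspace. (As a function of \<open>\<lambda>\<close> it need not be
  coercive, since \<open>A\<^sup>T\<close> may have a kernel.)

  The two duals are compared through
  \<open>\<phi>\<^sub>s\<^sub>e = \<phi>\<^sub>l\<^sub>s\<^sub>e + \<gamma> (Z - ln Z)\<close>. Moving along \<open>q\<close> leaves \<open>\<phi>\<^sub>l\<^sub>s\<^sub>e\<close> fixed and
  scales \<open>Z\<close> by \<open>exp (t / \<gamma>)\<close>, so minimizing over \<open>t\<close> amounts to making \<open>Z = 1\<close>,
  the unique minimizer of \<open>Z - ln Z\<close>.
\<close>

section \<open>The relative entropy of nonnegative vectors\<close>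

lemma minus_ln_ge_one:
  fixes w :: real
  assumes "w > 0"
  shows "w - ln w \<ge> 1" and "w - ln w = 1 \<longleftrightarrow> w = 1"
  using ln_le_minus_one[OF assms] ln_eq_minus_one[OF assms] by force+

text \<open>The terms of the relative entropy may be negative; after the correction by \<open>p - x\<close>,
  which sums to zero for vectors of equal mass, each of them is nonnegative.\<close>

lemma entropy_term_ge:
  fixes x p :: real
  assumes "x \<ge> 0" "p > 0"
  shows "x * ln (x / p) - x + p \<ge> 0"
    and "x * ln (x / p) - x + p = 0 \<longleftrightarrow> x = p"
proof -
  have eq: "x * ln (x / p) - x + p = x * (p / x - ln (p / x) - 1)" if "x > 0"
    using that assms by (simp add: ln_div field_simps)
  show "x * ln (x / p) - x + p \<ge> 0"
  proof (cases "x = 0")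
    case False
    then have "x > 0" using assms by simp
    then show ?thesis
      unfolding eq[OF \<open>x > 0\<close>] using minus_ln_ge_one(1)[of "p / x"] assms by simp
  qed (use assms in simp)
  show "x * ln (x / p) - x + p = 0 \<longleftrightarrow> x = p"
  proof (cases "x = 0")
    case False
    then have "x > 0" using assms by simp
    then have "x * ln (x / p) - x + p = 0 \<longleftrightarrow> p / x - ln (p / x) = 1"
      unfolding eq[OF \<open>x > 0\<close>] by auto
    also have "\<dots> \<longleftrightarrow> p / x = 1"
      using \<open>x > 0\<close> assms by (intro minus_ln_ge_one) simp
    finally show ?thesis using \<open>x > 0\<close> by auto
  qed (use assms in auto)
qed

lemma KL_nonneg_and_eq_0_iff:
  fixes x p :: "real^'n"
  assumes "\<And>j. x $ j \<ge> 0" "\<And>j. p $ j > 0"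
    and mass: "(\<Sum>j\<in>UNIV. x $ j) = (\<Sum>j\<in>UNIV. p $ j)"
  shows "KL x p \<ge> 0" and "KL x p = 0 \<longleftrightarrow> x = p"
proof -
  let ?f = "\<lambda>j. x $ j * ln (x $ j / p $ j) - x $ j + p $ j"
  have KL: "KL x p = (\<Sum>j\<in>UNIV. ?f j)"
    by (simp add: KL_def sum.distrib sum_subtractf mass)
  have nonneg: "?f j \<ge> 0" for j
    using entropy_term_ge(1) assms by blast
  show "KL x p \<ge> 0"
    unfolding KL by (simp add: nonneg sum_nonneg)
  have "KL x p = 0 \<longleftrightarrow> (\<forall>j. ?f j = 0)"
    unfolding KL by (subst sum_nonneg_eq_0_iff) (use nonneg in auto)
  also have "\<dots> \<longleftrightarrow> x = p"
    using entropy_term_ge(2) assms by (auto simp: vec_eq_iff)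
  finally show "KL x p = 0 \<longleftrightarrow> x = p" .
qed

section \<open>Responses and duals\<close>

lemma column_inner_eq_transpose_mult:
  fixes A :: "real^'n^'m"
  shows "column j A \<bullet> l = (transpose A *v l) $ j"
  by (simp add: matrix_vector_mul_component transpose_def column_def)

lemma matrix_mult_inner:
  fixes A :: "real^'n^'m"
  shows "(A *v x) \<bullet> l = (\<Sum>j\<in>UNIV. x $ j * (column j A \<bullet> l))"
proof -
  have "(A *v x) \<bullet> l = x \<bullet> (transpose A *v l)"
    unfolding transpose_matrix_vector by (metis dot_lmul_matrix inner_commute)
  then show ?thesis
    by (simp add: inner_vec_def[of x] column_inner_eq_transpose_mult)
qed

lemma x_resp_pos: "x_resp A c \<gamma> l $ j > 0"
  by (simp add: x_resp_def)

lemma Z_pos: "Z A c \<gamma> l > 0"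
  unfolding Z_def by (rule sum_pos) (auto simp: x_resp_pos)

lemma p_resp_pos: "p_resp A c \<gamma> l $ j > 0"
  by (simp add: p_resp_def x_resp_pos Z_pos)

lemma sum_p_resp: "(\<Sum>j\<in>UNIV. p_resp A c \<gamma> l $ j) = 1"
  using Z_pos[of A c \<gamma> l]
  by (simp add: p_resp_def Z_def flip: sum_divide_distrib)

lemma p_resp_eq_x_resp: "Z A c \<gamma> l = 1 \<Longrightarrow> p_resp A c \<gamma> l = x_resp A c \<gamma> l"
  by (simp add: p_resp_def vec_eq_iff)

lemma phi_lse_eq: "phi_lse A b c \<gamma> l = - (b \<bullet> l) + \<gamma> * ln (Z A c \<gamma> l)"
  by (simp add: phi_lse_def Z_def x_resp_def)

lemma phi_se_eq_phi_lse:
  "phi_se A b c \<gamma> l = phi_lse A b c \<gamma> l + \<gamma> * (Z A c \<gamma> l - ln (Z A c \<gamma> l))"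
  unfolding phi_lse_eq by (simp add: phi_se_def Z_def x_resp_def algebra_simps)

lemma column_inner_normalizer:
  fixes A :: "real^'n^'m"
  assumes "transpose A *v q = 1"
  shows "column j A \<bullet> q = 1"
  using assms by (simp add: column_inner_eq_transpose_mult)

lemma x_resp_shift:
  assumes "\<gamma> > 0" "transpose A *v q = 1"
  shows "x_resp A c \<gamma> (l + t *\<^sub>R q) = exp (t / \<gamma>) *\<^sub>R x_resp A c \<gamma> l"
  by (simp add: x_resp_def vec_eq_iff inner_add_right column_inner_normalizer[OF assms(2)]
        add_divide_distrib diff_divide_distrib exp_add exp_diff)

lemma Z_shift:
  assumes "\<gamma> > 0" "transpose A *v q = 1"
  shows "Z A c \<gamma> (l + t *\<^sub>R q) = exp (t / \<gamma>) * Z A c \<gamma> l"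
  by (simp add: Z_def x_resp_shift[OF assms] sum_distrib_left)

lemma phi_lse_shift:
  assumes "\<gamma> > 0" "transpose A *v q = 1" "q \<bullet> b = 1"
  shows "phi_lse A b c \<gamma> (l + t *\<^sub>R q) = phi_lse A b c \<gamma> l"
  using assms Z_pos[of A c \<gamma> l]
  by (simp add: phi_lse_eq Z_shift ln_mult inner_add_right inner_commute[of b q] algebra_simps)

lemma Z_shift_eq_1_iff:
  assumes "\<gamma> > 0" "transpose A *v q = 1"
  shows "Z A c \<gamma> (l + t *\<^sub>R q) = 1 \<longleftrightarrow> t = - \<gamma> * ln (Z A c \<gamma> l)"
proof -
  have "Z A c \<gamma> (l + t *\<^sub>R q) = 1 \<longleftrightarrow> ln (exp (t / \<gamma>) * Z A c \<gamma> l) = 0"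
    unfolding Z_shift[OF assms] using Z_pos[of A c \<gamma> l] by (subst ln_eq_zero_iff) auto
  also have "\<dots> \<longleftrightarrow> t / \<gamma> + ln (Z A c \<gamma> l) = 0"
    using Z_pos[of A c \<gamma> l] by (simp add: ln_mult)
  also have "\<dots> \<longleftrightarrow> t = - \<gamma> * ln (Z A c \<gamma> l)"
    using assms by (auto simp: field_simps)
  finally show ?thesis .
qed

section \<open>The duality gap as a relative entropy\<close>

lemma sum_eq_1_if_feasible:
  fixes A :: "real^'n^'m"
  shows "feasible A b x \<Longrightarrow> (\<Sum>j\<in>UNIV. x $ j) = 1"
  by (simp add: feasible_def inner_vec_def)

text \<open>Expanding \<open>ln p\<^sub>j(\<lambda>) = (a\<^sub>j \<bullet> \<lambda> - c\<^sub>j) / \<gamma> - ln Z(\<lambda>)\<close> makes the relative entropy affine in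
  these logarithms, and the constraints \<open>A x = b\<close> and \<open>1 \<bullet> x = 1\<close> evaluate the resulting sums.\<close>

lemma gamma_KL_eq_duality_gap:
  fixes A :: "real^'n^'m"
  assumes "\<gamma> > 0" and feas: "feasible A b x"
  shows "\<gamma> * KL x (p_resp A c \<gamma> l) = primal_obj c \<gamma> x + \<gamma> + phi_lse A b c \<gamma> l"
proof -
  let ?Z = "Z A c \<gamma> l"
  have ln_p: "ln (p_resp A c \<gamma> l $ j) = (column j A \<bullet> l - c $ j) / \<gamma> - ln ?Z" for j
    using Z_pos[of A c \<gamma> l] by (simp add: p_resp_def x_resp_def ln_div)
  have "\<gamma> * (x $ j * ln (x $ j / p_resp A c \<gamma> l $ j))
      = c $ j * x $ j + \<gamma> * (x $ j * (ln (x $ j) - 1)) + \<gamma> * x $ j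
        - x $ j * (column j A \<bullet> l) + \<gamma> * ln ?Z * x $ j" for j
  proof (cases "x $ j = 0")
    case False
    then have "x $ j > 0" using feas by (simp add: feasible_def order_less_le)
    then have "ln (x $ j / p_resp A c \<gamma> l $ j)
        = ln (x $ j) - ((column j A \<bullet> l - c $ j) / \<gamma> - ln ?Z)"
      using p_resp_pos[of A c \<gamma> l j] by (simp add: ln_div ln_p)
    then show ?thesis using assms(1) by (simp only:) (simp add: field_simps)
  qed simp
  then have "\<gamma> * KL x (p_resp A c \<gamma> l)
      = c \<bullet> x + \<gamma> * (\<Sum>j\<in>UNIV. x $ j * (ln (x $ j) - 1)) + \<gamma> * (\<Sum>j\<in>UNIV. x $ j)
        - (A *v x) \<bullet> l + \<gamma> * ln ?Z * (\<Sum>j\<in>UNIV. x $ j)"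
    by (simp add: KL_def sum_distrib_left sum.distrib sum_subtractf matrix_mult_inner
          inner_vec_def[of c])
  then show ?thesis
    using feas sum_eq_1_if_feasible[OF feas]
    by (simp add: primal_obj_def phi_lse_eq feasible_def)
qed

lemma KL_p_resp_of_feasible:
  fixes A :: "real^'n^'m"
  assumes "feasible A b x"
  shows "KL x (p_resp A c \<gamma> l) \<ge> 0"
    and "KL x (p_resp A c \<gamma> l) = 0 \<longleftrightarrow> x = p_resp A c \<gamma> l"
proof -
  have *: "\<And>j. x $ j \<ge> 0" "\<And>j. p_resp A c \<gamma> l $ j > 0"
    "(\<Sum>j\<in>UNIV. x $ j) = (\<Sum>j\<in>UNIV. p_resp A c \<gamma> l $ j)"
    using assms by (auto simp: feasible_def p_resp_pos sum_p_resp sum_eq_1_if_feasible)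
  show "KL x (p_resp A c \<gamma> l) \<ge> 0"
    and "KL x (p_resp A c \<gamma> l) = 0 \<longleftrightarrow> x = p_resp A c \<gamma> l"
    using KL_nonneg_and_eq_0_iff[OF *] by blast+
qed

text \<open>Fixing \<open>\<lambda>\<close> in the duality gap and varying \<open>x\<close> shows that a feasible normalized response is the only
  primal solution; fixing instead \<open>x\<close> shows that its multiplier is dual optimal.\<close>

lemma primal_solution_iff_if_p_resp_feasible:
  fixes A :: "real^'n^'m"
  assumes "\<gamma> > 0" and feas: "feasible A b (p_resp A c \<gamma> l0)"
  shows "primal_solution A b c \<gamma> x \<longleftrightarrow> x = p_resp A c \<gamma> l0"
proof -
  let ?x0 = "p_resp A c \<gamma> l0"
  note gap = gamma_KL_eq_duality_gap[OF \<open>\<gamma> > 0\<close>, where c = c and l = l0]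
  have gap0: "primal_obj c \<gamma> ?x0 + \<gamma> + phi_lse A b c \<gamma> l0 = 0"
    using gap[OF feas] KL_p_resp_of_feasible(2)[OF feas, of c \<gamma> l0] by simp
  have ge: "primal_obj c \<gamma> ?x0 \<le> primal_obj c \<gamma> y" if "feasible A b y" for y
  proof -
    have "\<gamma> * KL y ?x0 \<ge> 0"
      using KL_p_resp_of_feasible(1)[OF that, of c \<gamma> l0] \<open>\<gamma> > 0\<close> by simp
    then show ?thesis using gap[OF that] gap0 by linarith
  qed
  have uniq: "y = ?x0" if "feasible A b y" "primal_obj c \<gamma> y \<le> primal_obj c \<gamma> ?x0" for y
  proof -
    have "\<gamma> * KL y ?x0 \<le> 0"
      using gap[OF that(1)] gap0 that(2) by linarith
    then have "KL y ?x0 = 0"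
      using KL_p_resp_of_feasible(1)[OF that(1), of c \<gamma> l0] \<open>\<gamma> > 0\<close>
      by (simp add: mult_le_0_iff)
    then show ?thesis using KL_p_resp_of_feasible(2)[OF that(1)] by blast
  qed
  show ?thesis
    unfolding primal_solution_def is_arg_min_linorder using feas ge uniq by blast
qed

lemma phi_lse_excess_if_p_resp_feasible:
  fixes A :: "real^'n^'m"
  assumes "\<gamma> > 0" and feas: "feasible A b (p_resp A c \<gamma> l0)"
  shows "phi_lse A b c \<gamma> l - phi_lse A b c \<gamma> l0 = \<gamma> * KL (p_resp A c \<gamma> l0) (p_resp A c \<gamma> l)"
    and "phi_lse A b c \<gamma> l0 \<le> phi_lse A b c \<gamma> l"
proof -
  note gap = gamma_KL_eq_duality_gap[OF \<open>\<gamma> > 0\<close> feas, where c = c]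
  show eq: "phi_lse A b c \<gamma> l - phi_lse A b c \<gamma> l0
      = \<gamma> * KL (p_resp A c \<gamma> l0) (p_resp A c \<gamma> l)"
    using gap[of l] gap[of l0] KL_p_resp_of_feasible(2)[OF feas, of c \<gamma> l0] by simp
  have "\<gamma> * KL (p_resp A c \<gamma> l0) (p_resp A c \<gamma> l) \<ge> 0"
    using KL_p_resp_of_feasible(1)[OF feas, of c \<gamma> l] \<open>\<gamma> > 0\<close> by simp
  then show "phi_lse A b c \<gamma> l0 \<le> phi_lse A b c \<gamma> l"
    using eq by linarith
qed

section \<open>A multiplier with feasible response\<close>

text \<open>The tangent line of the exponential at the point \<open>ln s\<close>; varying the slope \<open>s\<close> gives linear lower
  bounds with any prescribed positive slope.\<close>

lemma exp_ge_tangent: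
  fixes s y :: real
  assumes "s > 0"
  shows "exp y \<ge> s * y + (s - s * ln s)"
proof -
  have "exp (y - ln s) \<ge> 1 + (y - ln s)"
    by (rule exp_ge_add_one_self)
  then have "s * exp (y - ln s) \<ge> s * (1 + (y - ln s))"
    using assms by simp
  moreover have "s * exp (y - ln s) = exp y"
    using assms by (simp add: exp_diff)
  ultimately show ?thesis by (simp add: algebra_simps)
qed

lemma exp_minus_linear_ge_abs:
  fixes \<gamma> c x :: real
  assumes "\<gamma> > 0" "x > 0"
  obtains C where "\<And>u. \<gamma> * exp ((u - c) / \<gamma>) - x * u \<ge> x * \<bar>u\<bar> - C"
proof
  let ?C = "\<bar>2 * x * c - \<gamma> * (2 * x - 2 * x * ln (2 * x))\<bar>"
  fix u
  \<comment> \<open>For \<open>u \<ge> 0\<close> the tangent of slope \<open>2 x\<close> leaves \<open>x u\<close> after subtraction; for \<open>u < 0\<close> the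
    linear part alone is \<open>x \<bar>u\<bar>\<close>.\<close>
  have "\<gamma> * exp ((u - c) / \<gamma>)
      \<ge> \<gamma> * (2 * x * ((u - c) / \<gamma>) + (2 * x - 2 * x * ln (2 * x)))"
    using exp_ge_tangent[of "2 * x" "(u - c) / \<gamma>"] assms by simp
  also have "\<gamma> * (2 * x * ((u - c) / \<gamma>) + (2 * x - 2 * x * ln (2 * x)))
      = 2 * (x * u) - (2 * x * c - \<gamma> * (2 * x - 2 * x * ln (2 * x)))"
    using assms by (simp add: field_simps)
  finally have "\<gamma> * exp ((u - c) / \<gamma>) - x * u \<ge> x * u - ?C"
    by linarith
  moreover have "\<gamma> * exp ((u - c) / \<gamma>) - x * u \<ge> - (x * u) - ?C"
    using assms(1) by (smt (verit) exp_gt_zero mult_pos_pos)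
  ultimately show "\<gamma> * exp ((u - c) / \<gamma>) - x * u \<ge> x * \<bar>u\<bar> - ?C"
    by (cases "u \<ge> 0") auto
qed

lemma coercive_attains_inf:
  fixes G :: "'a::euclidean_space \<Rightarrow> real"
  assumes "closed S" "0 \<in> S" "continuous_on S G" "m > 0"
    and coercive: "\<And>u. G u \<ge> m * norm u - C"
  obtains u0 where "u0 \<in> S" "\<And>u. u \<in> S \<Longrightarrow> G u0 \<le> G u"
proof -
  \<comment> \<open>Outside this radius the lower bound already exceeds the value at the origin.\<close>
  define R where "R = (G 0 + C) / m"
  let ?K = "S \<inter> cball 0 R"
  have "G 0 + C \<ge> 0" using coercive[of 0] by simp
  then have "0 \<in> ?K" using assms by (simp add: R_def)
  moreover have "compact ?K" using \<open>closed S\<close> by (simp add: closed_Int_compact)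
  moreover have "continuous_on ?K G"
    using assms(3) by (rule continuous_on_subset) blast
  ultimately obtain u0 where u0: "u0 \<in> ?K" "\<And>u. u \<in> ?K \<Longrightarrow> G u0 \<le> G u"
    using continuous_attains_inf[of ?K G] by blast
  have "G u0 \<le> G u" if "u \<in> S" for u
  proof (cases "norm u \<le> R")
    case True
    then show ?thesis using u0(2) that by simp
  next
    case False
    then have "G 0 + C \<le> m * norm u"
      using \<open>m > 0\<close> by (simp add: R_def field_simps)
    then have "G 0 \<le> G u" using coercive[of u] by linarith
    then show ?thesis using u0(2)[OF \<open>0 \<in> ?K\<close>] by linarith
  qed
  then show ?thesis using that u0(1) by blast
qed

text \<open>The minimization is carried out over \<open>u = A\<^sup>T \<lambda>\<close>. Writing \<open>b \<bullet> \<lambda>\<close> as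
  \<open>\<Sum>\<^sub>j x\<^sub>j u\<^sub>j\<close> for a positive \<open>x\<close> splits the dual into one-variable functions, and the smallest
  entry of \<open>x\<close> is a common rate of growth for all of them.\<close>

lemma phi_se_attains_inf:
  fixes A :: "real^'n^'m"
  assumes "\<gamma> > 0" and pos: "\<And>j. xbar $ j > 0" and "A *v xbar = b"
  obtains l0 where "\<And>l. phi_se A b c \<gamma> l0 \<le> phi_se A b c \<gamma> l"
proof -
  define G where "G u = (\<Sum>j\<in>UNIV. \<gamma> * exp ((u $ j - c $ j) / \<gamma>) - xbar $ j * u $ j)"
    for u :: "real^'n"
  have phi: "phi_se A b c \<gamma> l = G (transpose A *v l)" for l
    by (simp add: phi_se_def G_def sum_subtractf sum_distrib_left matrix_mult_inner
          column_inner_eq_transpose_mult flip: \<open>A *v xbar = b\<close>)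
  have "\<exists>C. \<forall>u. \<gamma> * exp ((u - c $ j) / \<gamma>) - xbar $ j * u \<ge> xbar $ j * \<bar>u\<bar> - C" for j
    using exp_minus_linear_ge_abs[OF \<open>\<gamma> > 0\<close> pos] by metis
  then obtain C where
    C: "\<And>j u. \<gamma> * exp ((u - c $ j) / \<gamma>) - xbar $ j * u \<ge> xbar $ j * \<bar>u\<bar> - C j"
    by metis
  define m where "m = Min (range (($) xbar))"
  have "m > 0" unfolding m_def by (subst Min_gr_iff) (auto simp: pos)
  have m_le: "m \<le> xbar $ j" for j unfolding m_def by (rule Min_le) auto
  have "m * norm u - sum C UNIV \<le> G u" for u
  proof -
    have "m * norm u \<le> m * (\<Sum>j\<in>UNIV. \<bar>u $ j\<bar>)"
      using norm_le_l1_cart \<open>m > 0\<close> by simp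
    also have "\<dots> \<le> (\<Sum>j\<in>UNIV. xbar $ j * \<bar>u $ j\<bar>)"
      unfolding sum_distrib_left by (intro sum_mono mult_right_mono m_le) simp
    finally have "m * norm u - sum C UNIV \<le> (\<Sum>j\<in>UNIV. xbar $ j * \<bar>u $ j\<bar> - C j)"
      by (simp add: sum_subtractf)
    also have "\<dots> \<le> G u" unfolding G_def by (intro sum_mono C)
    finally show ?thesis .
  qed
  moreover have "closed (range ((*v) (transpose A)))"
    by (intro closed_subspace linear_subspace_image subspace_UNIV matrix_vector_mul_linear)
  moreover have "0 \<in> range ((*v) (transpose A))"
    by (metis matrix_vector_mult_0_right rangeI)
  moreover have "continuous_on (range ((*v) (transpose A))) G"
    unfolding G_def using \<open>\<gamma> > 0\<close> by (intro continuous_intros) auto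
  ultimately obtain u0 where
    "u0 \<in> range ((*v) (transpose A))"
    "\<And>u. u \<in> range ((*v) (transpose A)) \<Longrightarrow> G u0 \<le> G u"
    using coercive_attains_inf[of "range ((*v) (transpose A))" G m "sum C UNIV"] \<open>m > 0\<close>
    by blast
  moreover from this(1) obtain l0 where "u0 = transpose A *v l0"
    by blast
  ultimately show ?thesis using that[of l0] by (simp add: phi)
qed

text \<open>The directional derivative of the sum-exp dual at \<open>\<lambda>\<^sub>0\<close> along \<open>d\<close> is
  \<open>(A x(\<lambda>\<^sub>0) - b) \<bullet> d\<close>.\<close>

lemma matrix_mult_x_resp_if_phi_se_minimal:
  fixes A :: "real^'n^'m"
  assumes "\<gamma> > 0" and min: "\<And>l. phi_se A b c \<gamma> l0 \<le> phi_se A b c \<gamma> l"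
  shows "A *v x_resp A c \<gamma> l0 = b"
proof -
  define d where "d = A *v x_resp A c \<gamma> l0 - b"
  have "((\<lambda>t. phi_se A b c \<gamma> (l0 + t *\<^sub>R d)) has_real_derivative
      - (b \<bullet> d) + (\<Sum>j\<in>UNIV. x_resp A c \<gamma> l0 $ j * (column j A \<bullet> d))) (at 0)"
    unfolding phi_se_def inner_add_right inner_scaleR_right x_resp_def
    using \<open>\<gamma> > 0\<close>
    by (auto intro!: derivative_eq_intros simp: sum_distrib_left)
  then have "- (b \<bullet> d) + (\<Sum>j\<in>UNIV. x_resp A c \<gamma> l0 $ j * (column j A \<bullet> d)) = 0"
    by (rule DERIV_local_min[where d = 1]) (use min in auto)
  then have "d \<bullet> d = 0"
    unfolding d_def inner_diff_left[of _ b] by (simp add: matrix_mult_inner)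
  then show ?thesis by (simp add: d_def)
qed

lemma exists_feasible_x_resp:
  fixes A :: "real^'n^'m"
  assumes "\<gamma> > 0" "transpose A *v q = 1" "q \<bullet> b = 1"
    and "\<exists>xbar. (\<forall>j. xbar $ j > 0) \<and> A *v xbar = b"
  obtains l0 where "feasible A b (x_resp A c \<gamma> l0)" "Z A c \<gamma> l0 = 1"
proof -
  obtain l0 where min: "\<And>l. phi_se A b c \<gamma> l0 \<le> phi_se A b c \<gamma> l"
    using assms phi_se_attains_inf by metis
  then have Ax: "A *v x_resp A c \<gamma> l0 = b"
    using matrix_mult_x_resp_if_phi_se_minimal \<open>\<gamma> > 0\<close> by blast
  have "Z A c \<gamma> l0 = (A *v x_resp A c \<gamma> l0) \<bullet> q"
    by (simp add: matrix_mult_inner column_inner_normalizer[OF assms(2)] Z_def)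
  also have "\<dots> = 1" by (simp add: Ax inner_commute[of b q] assms)
  finally have Z1: "Z A c \<gamma> l0 = 1" .
  then have "feasible A b (x_resp A c \<gamma> l0)"
    by (simp add: feasible_def Ax x_resp_pos less_imp_le inner_vec_def Z_def)
  then show ?thesis using that Z1 by blast
qed

section \<open>Comparison of the two duals\<close>

lemma INF_eq_if_minimal:
  fixes f :: "'a \<Rightarrow> real"
  assumes "\<And>l. f l0 \<le> f l"
  shows "(INF l. f l) = f l0"
  by (rule cInf_eq_minimum) (use assms in auto)

theorem proposition2p1:
  fixes A :: "real^'n^'m" and b q :: "real^'m" and c :: "real^'n" and \<gamma> :: real
  assumes "\<gamma> > 0"
    and "transpose A *v q = 1"
    and "q \<bullet> b = 1"
    and "\<exists>xbar :: real^'n. (\<forall>j. xbar $ j > 0) \<and> A *v xbar = b"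
  shows
    "(\<exists>!x. primal_solution A b c \<gamma> x) \<and>
     (\<exists>l. is_arg_min (phi_lse A b c \<gamma>) (\<lambda>_. True) l) \<and>
     (\<exists>l. is_arg_min (phi_se A b c \<gamma>) (\<lambda>_. True) l) \<and>
     (\<forall>l :: real^'m.
        (\<forall>t. is_arg_min (\<lambda>t. phi_se A b c \<gamma> (l + t *\<^sub>R q)) (\<lambda>_. True) t
              \<longleftrightarrow> t = - \<gamma> * ln (Z A c \<gamma> l)) \<and>
        phi_se A b c \<gamma> (l + (- \<gamma> * ln (Z A c \<gamma> l)) *\<^sub>R q) = phi_lse A b c \<gamma> l + \<gamma> \<and>
        x_resp A c \<gamma> (l + (- \<gamma> * ln (Z A c \<gamma> l)) *\<^sub>R q) = p_resp A c \<gamma> l \<and>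
        F_se A b c \<gamma> l
          = F_lse A b c \<gamma> l + \<gamma> * (Z A c \<gamma> l - 1 - ln (Z A c \<gamma> l)) \<and>
        F_lse A b c \<gamma> l = \<gamma> * KL (x_star A b c \<gamma>) (p_resp A c \<gamma> l))"
proof -
  note shift = \<open>\<gamma> > 0\<close> \<open>transpose A *v q = 1\<close>
  obtain l0 where feas: "feasible A b (x_resp A c \<gamma> l0)" and Z1: "Z A c \<gamma> l0 = 1"
    using exists_feasible_x_resp[OF assms] .
  have feas_p: "feasible A b (p_resp A c \<gamma> l0)"
    using feas by (simp add: p_resp_eq_x_resp[OF Z1])
  note sol = primal_solution_iff_if_p_resp_feasible[OF \<open>\<gamma> > 0\<close> feas_p]
  note excess = phi_lse_excess_if_p_resp_feasible[OF \<open>\<gamma> > 0\<close> feas_p]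
  have x_star: "x_star A b c \<gamma> = p_resp A c \<gamma> l0"
    by (simp add: x_star_def sol)
  have se0: "phi_se A b c \<gamma> l0 = phi_lse A b c \<gamma> l0 + \<gamma>"
    by (simp add: phi_se_eq_phi_lse Z1)
  have se_ge: "phi_se A b c \<gamma> l \<ge> phi_lse A b c \<gamma> l + \<gamma>" for l
    using minus_ln_ge_one(1)[OF Z_pos[of A c \<gamma> l]] \<open>\<gamma> > 0\<close> by (simp add: phi_se_eq_phi_lse)
  have se_eq_iff: "phi_se A b c \<gamma> l = phi_lse A b c \<gamma> l + \<gamma> \<longleftrightarrow> Z A c \<gamma> l = 1" for l
    using minus_ln_ge_one(2)[OF Z_pos[of A c \<gamma> l]] \<open>\<gamma> > 0\<close> by (simp add: phi_se_eq_phi_lse)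
  have se_min: "phi_se A b c \<gamma> l0 \<le> phi_se A b c \<gamma> l" for l
    using se0 se_ge[of l] excess(2)[of l] by linarith
  have lse_star: "phi_lse_star A b c \<gamma> = phi_lse A b c \<gamma> l0"
    unfolding phi_lse_star_def by (rule INF_eq_if_minimal) (rule excess(2))
  have se_star: "phi_se_star A b c \<gamma> = phi_lse A b c \<gamma> l0 + \<gamma>"
    unfolding phi_se_star_def se0[symmetric] by (rule INF_eq_if_minimal) (rule se_min)
  have "\<exists>!x. primal_solution A b c \<gamma> x"
    by (simp add: sol)
  moreover have "\<exists>l. is_arg_min (phi_lse A b c \<gamma>) (\<lambda>_. True) l"
    using excess(2) by (auto simp: is_arg_min_linorder)
  moreover have "\<exists>l. is_arg_min (phi_se A b c \<gamma>) (\<lambda>_. True) l"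
    using se_min by (auto simp: is_arg_min_linorder)
  moreover have "is_arg_min (\<lambda>t. phi_se A b c \<gamma> (l + t *\<^sub>R q)) (\<lambda>_. True) t
      \<longleftrightarrow> t = - \<gamma> * ln (Z A c \<gamma> l)"
    and "phi_se A b c \<gamma> (l + (- \<gamma> * ln (Z A c \<gamma> l)) *\<^sub>R q) = phi_lse A b c \<gamma> l + \<gamma>"
    for l t
  proof -
    let ?t = "- \<gamma> * ln (Z A c \<gamma> l)"
    have lse: "phi_lse A b c \<gamma> (l + s *\<^sub>R q) = phi_lse A b c \<gamma> l" for s
      by (rule phi_lse_shift[OF assms(1-3)])
    have ge: "phi_se A b c \<gamma> (l + s *\<^sub>R q) \<ge> phi_lse A b c \<gamma> l + \<gamma>" for s
      using se_ge[of "l + s *\<^sub>R q"] by (simp add: lse)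
    have eq_iff: "phi_se A b c \<gamma> (l + s *\<^sub>R q) = phi_lse A b c \<gamma> l + \<gamma> \<longleftrightarrow> s = ?t" for s
      using se_eq_iff[of "l + s *\<^sub>R q"] unfolding lse Z_shift_eq_1_iff[OF shift] .
    show val: "phi_se A b c \<gamma> (l + ?t *\<^sub>R q) = phi_lse A b c \<gamma> l + \<gamma>"
      using eq_iff by blast
    show "is_arg_min (\<lambda>t. phi_se A b c \<gamma> (l + t *\<^sub>R q)) (\<lambda>_. True) t \<longleftrightarrow> t = ?t"
      unfolding is_arg_min_linorder using ge eq_iff val by (metis order_antisym)
  qed
  moreover have "x_resp A c \<gamma> (l + (- \<gamma> * ln (Z A c \<gamma> l)) *\<^sub>R q) = p_resp A c \<gamma> l" for l
  proof -
    have "exp (- \<gamma> * ln (Z A c \<gamma> l) / \<gamma>) = inverse (Z A c \<gamma> l)"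
      using \<open>\<gamma> > 0\<close> Z_pos[of A c \<gamma> l] by (simp add: exp_minus)
    then show ?thesis
      by (simp only: x_resp_shift[OF shift])
        (simp add: p_resp_def vec_eq_iff divide_inverse mult.commute)
  qed
  moreover have "F_se A b c \<gamma> l
      = F_lse A b c \<gamma> l + \<gamma> * (Z A c \<gamma> l - 1 - ln (Z A c \<gamma> l))" for l
    by (simp add: F_se_def F_lse_def se_star lse_star phi_se_eq_phi_lse algebra_simps)
  moreover have "F_lse A b c \<gamma> l = \<gamma> * KL (x_star A b c \<gamma>) (p_resp A c \<gamma> l)" for l
    by (simp add: F_lse_def lse_star x_star excess(1))
  ultimately show ?thesis by blast
qed

end
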